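(* Let $\mathbb{F}$ be a field of characteristic zero and let $\psi$ be the $\mathbb{F}$-linear functional on $\mathbb{F}[\alpha_1,\alpha_2]$ defined on monomials by $\psi(\alpha_1^{2m}\alpha_2^{2n})=\Omega(m,n)1_{\mathbb{F}}$ for $m,n\in\mathbb{N}$ and $\psi(\alpha_1^k\alpha_2^l)=0$ if $k$ or $l$ is odd. Then $\psi(h\cdot\pi)=\psi(\pi)$ for all $\pi\in\mathbb{F}[\alpha_1,\alpha_2]$ and all $h\in SO(2,\mathbb{F})$.
   Context: $\mathbb{N}$ includes $0$. $\Omega(m,n)=\dfrac{(2m)!(2n)!}{4^{m+n}\,m!\,n!\,(m+n)!}$, and $a1_{\mathbb{F}}$ is the image of $a\in\mathbb{Q}$ in $\mathbb{F}$. $SO(2,\mathbb{F})$ is the group of $2\times2$ matrices $h$ over $\mathbb{F}$ with $h^{-1}=h^T$ and $\det h=1$; it acts on $\mathbb{F}[\alpha_1,\alpha_2]$ by $h\cdot\pi(\alpha_1,\alpha_2)=\pi(h_{11}\alpha_1+h_{21}\alpha_2,\,h_{12}\alpha_1+h_{22}\alpha_2)$. *)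

theory Defs
  imports "HOL-Analysis.Determinants" "HOL-Computational_Algebra.Polynomial"
begin

definition Omega :: "nat \<Rightarrow> nat \<Rightarrow> rat" where
  "Omega m n = (fact (2 * m) * fact (2 * n)) / (4 ^ (m + n) * fact m * fact n * fact (m + n))"

text \<open>
  The ring \<open>F[\<alpha>1, \<alpha>2]\<close> is rendered as the iterated polynomial ring \<open>F[\<alpha>1][\<alpha>2]\<close>: the
  coefficient of \<open>\<alpha>1^k \<alpha>2^l\<close> in \<open>p\<close> is \<open>coeff (coeff p l) k\<close>.
\<close>

type_synonym 'a bipoly = "'a poly poly"

definition Const :: "'a::comm_ring_1 \<Rightarrow> 'a bipoly" where
  "Const c = [:[:c:]:]"

definition alpha1 :: "'a::comm_ring_1 bipoly" where
  "alpha1 = [:[:0, 1:]:]"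

definition alpha2 :: "'a::comm_ring_1 bipoly" where
  "alpha2 = [:0, 1:]"

definition bipoly_scale :: "'a::comm_ring_1 \<Rightarrow> 'a bipoly \<Rightarrow> 'a bipoly" where
  "bipoly_scale c p = smult [:c:] p"

definition bipoly_subst :: "'a::comm_ring_1 bipoly \<Rightarrow> 'a bipoly \<Rightarrow> 'a bipoly \<Rightarrow> 'a bipoly" where
  "bipoly_subst p u v = poly (map_poly (\<lambda>q. poly (map_poly Const q) u) p) v"

definition SO2 :: "('a::field ^ 2 ^ 2) set" where
  "SO2 = {h. invertible h \<and> matrix_inv h = transpose h \<and> det h = 1}"

text \<open>In the matrix type \<open>h $ i $ j\<close> is the entry in row \<open>i\<close> and column \<open>j\<close>.\<close>

definition act :: "'a::comm_ring_1 ^ 2 ^ 2 \<Rightarrow> 'a bipoly \<Rightarrow> 'a bipoly" where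
  "act h p = bipoly_subst p
     (bipoly_scale (h $ 1 $ 1) alpha1 + bipoly_scale (h $ 2 $ 1) alpha2)
     (bipoly_scale (h $ 1 $ 2) alpha1 + bipoly_scale (h $ 2 $ 2) alpha2)"

lemma alpha_monom: "alpha1 ^ k * alpha2 ^ l = (monom (monom 1 k) l :: 'a::comm_ring_1 bipoly)"
proof -
  have "alpha2 ^ l = (monom 1 l :: 'a bipoly)" for l
    by (simp add: alpha2_def monom_altdef)
  moreover have "alpha1 ^ k = [:monom 1 k :: 'a poly:]" for k
    by (induction k) (auto simp: alpha1_def monom_Suc one_pCons)
  ultimately show ?thesis by (simp add: smult_monom)
qed

lemma map_poly_Const_add: "map_poly Const (p + q) = map_poly Const p + map_poly Const q"
  by (intro poly_eqI) (simp add: coeff_map_poly Const_def)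

lemma bipoly_subst_add: "bipoly_subst (p + q) u v = bipoly_subst p u v + bipoly_subst q u v"
proof -
  have "map_poly (\<lambda>q. poly (map_poly Const q) u) (p + q)
      = map_poly (\<lambda>q. poly (map_poly Const q) u) p + map_poly (\<lambda>q. poly (map_poly Const q) u) q"
    by (intro poly_eqI) (simp add: coeff_map_poly map_poly_Const_add)
  then show ?thesis by (simp add: bipoly_subst_def)
qed

lemma bipoly_subst_monom: "bipoly_subst (bipoly_scale c (alpha1 ^ k * alpha2 ^ l)) u v = bipoly_scale c (u ^ k * v ^ l)"
  by (simp add: alpha_monom bipoly_subst_def bipoly_scale_def smult_monom map_poly_monom poly_monom Const_def)

text \<open>A functional with the prescribed values on monomials exists and is unique.\<close>

lemma linear_functional_ex1:
  fixes w :: "nat \<Rightarrow> nat \<Rightarrow> 'a::field"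
  shows "\<exists>!\<psi>. Vector_Spaces.linear bipoly_scale (*) \<psi> \<and> (\<forall>k l. \<psi> (alpha1 ^ k * alpha2 ^ l) = w k l)"
proof -
  have vs: "vector_space (bipoly_scale :: 'a \<Rightarrow> _)" "vector_space ((*) :: 'a \<Rightarrow> _)"
    by unfold_locales (simp_all add: bipoly_scale_def smult_add_right smult_add_left[symmetric] one_pCons[symmetric] algebra_simps)
  show ?thesis
  proof (rule ex_ex1I)
    define f where "f q l = (\<Sum>k | coeff q k \<noteq> 0. coeff q k * w k l)" for q l
    define g where "g p = (\<Sum>l | coeff p l \<noteq> 0. f (coeff p l) l)" for p
    have f: "f q l = (\<Sum>k\<le>N. coeff q k * w k l)" if "degree q \<le> N" for q l N
      unfolding f_def using that
      by (intro sum.mono_neutral_left) (auto dest: le_degree)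
    have f0: "f 0 l = 0" for l by (simp add: f_def)
    have g: "g p = (\<Sum>l\<le>N. f (coeff p l) l)" if "degree p \<le> N" for p N
      unfolding g_def using that
      by (intro sum.mono_neutral_left) (auto dest: le_degree simp: f0)
    have fadd: "f (p + q) l = f p l + f q l" for p q l
    proof -
      define N where "N = max (degree p) (degree q)"
      have "degree p \<le> N" "degree q \<le> N" "degree (p + q) \<le> N"
        by (auto simp: N_def degree_add_le)
      then show ?thesis by (simp add: f algebra_simps sum.distrib)
    qed
    have gadd: "g (p + q) = g p + g q" for p q
    proof -
      define N where "N = max (degree p) (degree q)"
      have "degree p \<le> N" "degree q \<le> N" "degree (p + q) \<le> N"
        by (auto simp: N_def degree_add_le)
      then show ?thesis by (simp add: g fadd sum.distrib)
    qed
    have fsc: "f (smult c p) l = c * f p l" for c p l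
      using f[OF degree_smult_le[of c p]] f[OF order_refl, of p] 
      by (simp add: sum_distrib_left algebra_simps)
    have gsc: "g (bipoly_scale c p) = c * g p" for c p
      using g[OF degree_smult_le[of "[:c:]" p]] g[OF order_refl, of p]
      by (simp add: bipoly_scale_def fsc sum_distrib_left)
    have fm: "f (monom 1 k) l = w k l" for k l
      by (simp add: f[OF degree_monom_le] if_distrib[of "\<lambda>x. x * _"] sum.delta cong: if_cong)
    have "g (monom (monom 1 k) l) = (\<Sum>l'\<le>l. if l' = l then w k l else 0)" for k l
      unfolding g[OF degree_monom_le] by (intro sum.cong) (auto simp: fm f0)
    then have "g (monom (monom 1 k) l) = w k l" for k l by simp
    with vs gadd gsc show "\<exists>\<psi>. Vector_Spaces.linear bipoly_scale (*) \<psi> \<and>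
        (\<forall>k l. \<psi> (alpha1 ^ k * alpha2 ^ l) = w k l)"
      by (intro exI[of _ g]) (auto simp: alpha_monom Vector_Spaces.linear_iff)
  next
    fix \<psi> \<phi>
    assume A: "Vector_Spaces.linear bipoly_scale (*) \<psi> \<and> (\<forall>k l. \<psi> (alpha1 ^ k * alpha2 ^ l) = w k l)"
      and B: "Vector_Spaces.linear bipoly_scale (*) \<phi> \<and> (\<forall>k l. \<phi> (alpha1 ^ k * alpha2 ^ l) = w k l)"
    interpret A: Vector_Spaces.linear bipoly_scale "(*)" \<psi> using A by blast
    interpret B: Vector_Spaces.linear bipoly_scale "(*)" \<phi> using B by blast
    show "\<psi> = \<phi>"
    proof
      fix p :: "'a bipoly"
      have "p = (\<Sum>l\<le>degree p. \<Sum>k\<le>degree (coeff p l).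
          bipoly_scale (coeff (coeff p l) k) (alpha1 ^ k * alpha2 ^ l))"
      proof -
        have "(\<Sum>k\<le>degree q. bipoly_scale (coeff q k) (alpha1 ^ k * alpha2 ^ l)) = monom q l" for q :: "'a poly" and l
        proof -
          have "(\<Sum>k\<le>degree q. bipoly_scale (coeff q k) (alpha1 ^ k * alpha2 ^ l))
              = (\<Sum>k\<le>degree q. monom (monom (coeff q k) k) l)"
            by (simp add: alpha_monom bipoly_scale_def smult_monom)
          also have "\<dots> = monom (\<Sum>k\<le>degree q. monom (coeff q k) k) l"
            by (intro poly_eqI) (simp add: coeff_sum)
          finally show ?thesis by (simp add: poly_as_sum_of_monoms)
        qed
        then show ?thesis by (simp only: poly_as_sum_of_monoms)
      qed
      then obtain c and D :: "nat \<Rightarrow> nat" and d where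
        p: "p = (\<Sum>l\<le>d. \<Sum>k\<le>D l. bipoly_scale (c l k) (alpha1 ^ k * alpha2 ^ l))"
        by (meson that)
      show "\<psi> p = \<phi> p"
        unfolding p using A B by (simp add: A.sum B.sum A.scale B.scale)
    qed
  qed
qed

end

theory Submission imports Defs begin

text \<open>
  Let \<open>D = \<alpha>1 \<partial>/\<partial>\<alpha>2 - \<alpha>2 \<partial>/\<partial>\<alpha>1\<close> be the infinitesimal rotation. The functional \<open>\<psi>\<close> kills the image
  of \<open>D\<close> and is unchanged by multiplication with \<open>\<alpha>1^2 + \<alpha>2^2\<close>. If \<open>u\<close> and \<open>v\<close> are the images of
  \<open>\<alpha>1\<close> and \<open>\<alpha>2\<close> under \<open>h\<close>, then \<open>D u = -v\<close>, \<open>D v = u\<close> and \<open>u^2 + v^2 = \<alpha>1^2 + \<alpha>2^2\<close>, so the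
  moments \<open>\<psi> (u^k v^l)\<close> and \<open>\<psi> (\<alpha>1^k \<alpha>2^l)\<close> satisfy the same recurrences. In characteristic zero
  these recurrences determine all moments from the one with \<open>k = l = 0\<close>.
\<close>

lemma bipoly_scale_conv_mult: "bipoly_scale c p = Const c * p"
  by (simp add: bipoly_scale_def Const_def)

lemma bipoly_subst_scale: "bipoly_subst (bipoly_scale c p) u v = bipoly_scale c (bipoly_subst p u v)"
proof -
  have "map_poly Const (smult c q) = smult (Const c) (map_poly Const q)" for q :: "'a poly"
    by (intro poly_eqI) (simp add: coeff_map_poly Const_def)
  then have "map_poly (\<lambda>q. poly (map_poly Const q) u) (smult [:c:] p)
      = smult (Const c) (map_poly (\<lambda>q. poly (map_poly Const q) u) p)"
    by (intro poly_eqI) (simp add: coeff_map_poly)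
  then show ?thesis
    by (simp add: bipoly_subst_def bipoly_scale_conv_mult) (simp add: Const_def)
qed

lemma bipoly_functional_linearI:
  fixes f :: "'a::field bipoly \<Rightarrow> 'a"
  assumes "\<And>p q. f (p + q) = f p + f q" and "\<And>c p. f (bipoly_scale c p) = c * f p"
  shows "Vector_Spaces.linear bipoly_scale (*) f"
proof -
  have "vector_space (bipoly_scale :: 'a \<Rightarrow> _)" "vector_space ((*) :: 'a \<Rightarrow> _)"
    by unfold_locales (simp_all add: bipoly_scale_def smult_add_right smult_add_left[symmetric]
        one_pCons[symmetric] algebra_simps)
  with assms show ?thesis by (simp add: Vector_Spaces.linear_iff)
qed

text \<open>This is the uniqueness part of \<open>linear_functional_ex1\<close>, with the moments of
  \<open>g\<close> as prescribed values. It reduces each identity between functionals to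
  monomials.\<close>

lemma bipoly_functional_eqI:
  fixes f g :: "'a::field bipoly \<Rightarrow> 'a"
  assumes "Vector_Spaces.linear bipoly_scale (*) f" "Vector_Spaces.linear bipoly_scale (*) g"
    and "\<And>k l. f (alpha1 ^ k * alpha2 ^ l) = g (alpha1 ^ k * alpha2 ^ l)"
  shows "f = g"
  using linear_functional_ex1[of "\<lambda>k l. g (alpha1 ^ k * alpha2 ^ l)"] assms by blast

text \<open>The outer variable is \<open>alpha2\<close>, so \<open>pderiv\<close> differentiates in
  \<open>alpha2\<close>, while \<open>map_poly pderiv\<close> differentiates the coefficients, that
  is, in \<open>alpha1\<close>.\<close>

definition rotation_deriv :: "'a::idom bipoly \<Rightarrow> 'a bipoly" where
  "rotation_deriv p = alpha1 * pderiv p - alpha2 * map_poly pderiv p"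

lemma map_poly_pderiv_add: "map_poly pderiv (p + q) = map_poly pderiv p + map_poly pderiv q"
  by (intro poly_eqI) (simp add: coeff_map_poly pderiv_add)

lemma map_poly_pderiv_mult:
  fixes p q :: "'a::idom bipoly"
  shows "map_poly pderiv (p * q) = p * map_poly pderiv q + map_poly pderiv p * q"
proof (rule poly_eqI)
  fix n
  have "pderiv (\<Sum>i\<le>n. coeff p i * coeff q (n - i))
      = (\<Sum>i\<le>n. pderiv (coeff p i * coeff q (n - i)))"
    using higher_pderiv_sum[of 1] by simp
  then show "coeff (map_poly pderiv (p * q)) n = coeff (p * map_poly pderiv q + map_poly pderiv p * q) n"
    by (simp add: coeff_map_poly coeff_mult pderiv_mult sum.distrib)
      (simp add: mult.commute)
qed

lemma rotation_deriv_add: "rotation_deriv (p + q) = rotation_deriv p + rotation_deriv q"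
  by (simp add: rotation_deriv_def map_poly_pderiv_add pderiv_add algebra_simps)

lemma rotation_deriv_mult: "rotation_deriv (p * q) = p * rotation_deriv q + rotation_deriv p * q"
  by (simp add: rotation_deriv_def map_poly_pderiv_mult pderiv_mult algebra_simps)

lemma rotation_deriv_Const [simp]: "rotation_deriv (Const c) = 0"
  by (simp add: rotation_deriv_def Const_def pderiv_pCons map_poly_pCons)

lemma rotation_deriv_alpha1 [simp]: "rotation_deriv alpha1 = - alpha2"
  by (simp add: rotation_deriv_def alpha1_def pderiv_pCons map_poly_pCons one_pCons[symmetric])

lemma rotation_deriv_alpha2 [simp]: "rotation_deriv alpha2 = alpha1"
  by (simp add: rotation_deriv_def alpha2_def pderiv_pCons map_poly_pCons)

lemma rotation_deriv_scale: "rotation_deriv (bipoly_scale c p) = bipoly_scale c (rotation_deriv p)"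
  by (simp add: bipoly_scale_conv_mult rotation_deriv_mult)

lemma rotation_deriv_power: "rotation_deriv (p ^ n) = of_nat n * p ^ (n - 1) * rotation_deriv p"
proof (induction n)
  case 0
  show ?case using rotation_deriv_Const[of 1] by (simp add: Const_def one_pCons[symmetric])
next
  case (Suc n)
  then show ?case by (cases n) (simp_all add: rotation_deriv_mult algebra_simps)
qed

text \<open>The hypotheses hold both for \<open>alpha1\<close>, \<open>alpha2\<close> and for their
  images under a rotation. At \<open>k = 0\<close> or \<open>l = 0\<close> the truncated exponent is
  harmless because its factor \<open>of_nat k\<close> or \<open>of_nat l\<close> vanishes.\<close>

lemma rotation_deriv_monomial:
  assumes "rotation_deriv u = - v" "rotation_deriv v = u"
  shows "rotation_deriv (u ^ k * v ^ l)
    = of_nat l * (u ^ Suc k * v ^ (l - 1)) - of_nat k * (u ^ (k - 1) * v ^ Suc l)"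
  using assms by (simp add: rotation_deriv_mult rotation_deriv_power algebra_simps)

text \<open>Induction on the total degree. Once \<open>E i j = 0\<close>, \<open>circ\<close> makes
  \<open>E (i + 2) j\<close> and \<open>E i (j + 2)\<close> opposite, while \<open>rot\<close> makes
  positive integer multiples of them equal, so in characteristic zero both vanish.\<close>

lemma circle_moments_zero:
  fixes E :: "nat \<Rightarrow> nat \<Rightarrow> 'a::field_char_0"
  assumes rot: "\<And>k l. of_nat l * E (Suc k) (l - 1) = of_nat k * E (k - 1) (Suc l)"
    and circ: "\<And>k l. E (k + 2) l + E k (l + 2) = E k l"
    and "E 0 0 = 0"
  shows "E k l = 0"
proof (induction "k + l" arbitrary: k l rule: less_induct)
  case less
  have pair: "E (i + 2) j = 0 \<and> E i (j + 2) = 0" if "i + j < k + l" for i j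
  proof -
    have "E i j = 0" using less that by blast
    then have neg: "E i (j + 2) = - E (i + 2) j" using circ[of i j] by (simp add: eq_neg_iff_add_eq_0 add.commute)
    have "of_nat (Suc j) * E (i + 2) j = of_nat (Suc i) * E i (j + 2)"
      using rot[of "Suc j" "Suc i"] by simp
    then have "(of_nat (Suc j) + of_nat (Suc i)) * E (i + 2) j = 0"
      by (simp only: neg distrib_right mult_minus_right add.left_inverse right_minus add.right_inverse)
    moreover have "of_nat (Suc j) + of_nat (Suc i) \<noteq> (0::'a)"
      unfolding of_nat_add[symmetric] of_nat_eq_0_iff by simp
    ultimately have "E (i + 2) j = 0" by (simp del: of_nat_Suc)
    with neg show ?thesis by simp
  qed
  consider i where "k = i + 2" | j where "l = j + 2" | "k \<le> 1" "l \<le> 1"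
    by (cases "k \<le> 1"; cases "l \<le> 1") (use le_Suc_ex[of 2 k] le_Suc_ex[of 2 l] in \<open>auto simp: add.commute not_le\<close>)
  then show ?case
  proof cases
    case 3
    then have "k = 0 \<or> k = 1" "l = 0 \<or> l = 1" by auto
    \<comment> \<open>With \<open>k = 0\<close> or \<open>l = 0\<close> one side of
      \<open>rot\<close> is zero; the case \<open>E 1 1\<close> uses that 2 is nonzero.\<close>
    moreover have "E 1 0 = 0" "E 1 1 = 0" "E 0 1 = 0"
      using rot[of 1 0] rot[of 2 0] rot[of 0 1] by simp_all
    ultimately show ?thesis using assms(3) by auto
  qed (use pair in auto)
qed

text \<open>The quotient of consecutive values is (2m+2)(2m+1) / (4(m+1)(m+n+1)) = (2m+1) /
  (2(m+n+1)). The second identity follows from the symmetry of \<open>Omega\<close>.\<close>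

lemma Omega_Suc:
  "2 * of_nat (m + n + 1) * Omega (Suc m) n = of_nat (2 * m + 1) * Omega m n"
  "2 * of_nat (m + n + 1) * Omega m (Suc n) = of_nat (2 * n + 1) * Omega m n"
proof -
  have f: "fact (2 * Suc i) = (2 * of_nat (Suc i)) * of_nat (2 * i + 1) * (fact (2 * i) :: rat)" for i
    by (simp add: algebra_simps)
  have *: "2 * of_nat (m + n + 1) * Omega (Suc m) n = of_nat (2 * m + 1) * Omega m n" for m n
  proof -
    have "of_nat (Suc m) \<noteq> (0::rat)" "of_nat (m + n + 1) \<noteq> (0::rat)"
      unfolding of_nat_eq_0_iff by simp_all
    moreover have "fact (Suc m) = of_nat (Suc m) * (fact m :: rat)"
      "fact (Suc m + n) = of_nat (m + n + 1) * (fact (m + n) :: rat)"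
      "(4::rat) ^ (Suc m + n) = 2 * 2 * 4 ^ (m + n)" by simp_all
    ultimately show ?thesis
      unfolding Omega_def f by (simp add: divide_simps del: of_nat_Suc of_nat_add fact_Suc)
  qed
  have "Omega i j = Omega j i" for i j by (simp add: Omega_def ac_simps)
  with *[of m n] *[of n m] show
    "2 * of_nat (m + n + 1) * Omega (Suc m) n = of_nat (2 * m + 1) * Omega m n"
    "2 * of_nat (m + n + 1) * Omega m (Suc n) = of_nat (2 * n + 1) * Omega m n"
    by (simp_all add: ac_simps)
qed

text \<open>By \<open>Omega_Suc\<close>, both sides times 2(m+n+1) equal (2m+1)(2n+1)
  \<open>Omega m n\<close>.\<close>

lemma Omega_rotation: "of_nat (2 * n + 1) * Omega (Suc m) n = of_nat (2 * m + 1) * Omega m (Suc n)"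
proof -
  have "2 * of_nat (m + n + 1) * (of_nat (2 * n + 1) * Omega (Suc m) n)
      = 2 * of_nat (m + n + 1) * (of_nat (2 * m + 1) * Omega m (Suc n))"
    using Omega_Suc[of m n] by (metis mult.left_commute)
  moreover have "2 * of_nat (m + n + 1) \<noteq> (0::rat)" by (simp del: of_nat_add)
  ultimately show ?thesis by (metis mult_left_cancel)
qed

text \<open>By \<open>Omega_Suc\<close>, this amounts to (2m+1) + (2n+1) = 2(m+n+1).\<close>

lemma Omega_circle: "Omega (Suc m) n + Omega m (Suc n) = Omega m n"
proof -
  have "2 * of_nat (m + n + 1) * (Omega (Suc m) n + Omega m (Suc n))
      = 2 * of_nat (m + n + 1) * Omega m n"
    unfolding distrib_left Omega_Suc by (simp add: algebra_simps)
  moreover have "2 * of_nat (m + n + 1) \<noteq> (0::rat)" by (simp del: of_nat_add)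
  ultimately show ?thesis by (metis mult_left_cancel)
qed

lemma SO2_entries:
  fixes h :: "'a::field ^ 2 ^ 2"
  assumes "h \<in> SO2"
  shows "h $ 2 $ 2 = h $ 1 $ 1" "h $ 1 $ 2 = - (h $ 2 $ 1)" "h $ 1 $ 1 ^ 2 + h $ 2 $ 1 ^ 2 = 1"
proof -
  define a b c d where abcd: "a = h $ 1 $ 1" "b = h $ 1 $ 2" "c = h $ 2 $ 1" "d = h $ 2 $ 2"
  \<comment> \<open>\<open>matrix_inv\<close> is a choice; invertibility supplies the witness that
    makes the chosen matrix an inverse.\<close>
  have "matrix_inv h ** h = mat 1"
    using assms someI_ex[of "\<lambda>A. h ** A = mat 1 \<and> A ** h = mat 1"]
    by (simp add: SO2_def matrix_inv_def invertible_def)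
  then have "transpose h ** h = mat 1"
    using assms by (simp add: SO2_def)
  then have "(transpose h ** h) $ 1 $ 1 = 1" "(transpose h ** h) $ 1 $ 2 = 0"
    by (simp_all add: mat_def)
  then have 1: "a * a + c * c = 1" "a * b + c * d = 0"
    by (simp_all add: abcd matrix_matrix_mult_def transpose_def sum_2)
  have 2: "a * d - b * c = 1"
    using assms by (simp add: SO2_def det_2 abcd)
  \<comment> \<open>Multiply \<open>d\<close> and \<open>b\<close> by a^2 + c^2 = 1 and simplify
    with the other two equations.\<close>
  from 1 2 have "d = a" "b = - c" by algebra+
  with 1 show "h $ 2 $ 2 = h $ 1 $ 1" "h $ 1 $ 2 = - (h $ 2 $ 1)" "h $ 1 $ 1 ^ 2 + h $ 2 $ 1 ^ 2 = 1"
    by (simp_all add: abcd power2_eq_square)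
qed

theorem theorem12:
  fixes \<psi> :: "'a::field_char_0 bipoly \<Rightarrow> 'a"
    and \<pi> :: "'a bipoly"
    and h :: "'a ^ 2 ^ 2"
  assumes "Vector_Spaces.linear bipoly_scale (*) \<psi>"
    and "\<And>m n. \<psi> (alpha1 ^ (2 * m) * alpha2 ^ (2 * n)) = of_rat (Omega m n)"
    and "\<And>k l. odd k \<or> odd l \<Longrightarrow> \<psi> (alpha1 ^ k * alpha2 ^ l) = 0"
    and "h \<in> SO2"
  shows "\<psi> (act h \<pi>) = \<psi> \<pi>"
proof -
  interpret Vector_Spaces.linear bipoly_scale "(*)" \<psi> by fact
  note psi_even = assms(2) and psi_odd = assms(3)
  have psi_of_nat: "\<psi> (of_nat n * p) = of_nat n * \<psi> p" for n p
    by (induction n) (simp_all add: algebra_simps add)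
  define M where "M k l = \<psi> (alpha1 ^ k * alpha2 ^ l)" for k l
  have rot_mono: "\<psi> (rotation_deriv (alpha1 ^ k * alpha2 ^ l)) = 0" for k l
  proof -
    have "of_nat l * M (Suc k) (l - 1) = of_nat k * M (k - 1) (Suc l)"
    proof (cases "odd k \<and> odd l")
      case True
      then obtain m n where kl: "k = 2 * m + 1" "l = 2 * n + 1" by (auto elim!: oddE)
      have eqs: "M (Suc k) (l - 1) = of_rat (Omega (Suc m) n)" "M (k - 1) (Suc l) = of_rat (Omega m (Suc n))"
        using psi_even[of "Suc m" n] psi_even[of m "Suc n"] by (simp_all add: M_def kl)
      show ?thesis
        using arg_cong[OF Omega_rotation, of "of_rat :: rat \<Rightarrow> 'a" n m]
        by (simp only: of_rat_mult of_rat_of_nat_eq kl eqs[unfolded kl])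
    next
      \<comment> \<open>If one exponent is even, each shifted monomial contains an odd power, unless
        truncation at 0 intervenes, and then the coefficient is zero.\<close>
      case False
      then have "l = 0 \<or> M (Suc k) (l - 1) = 0" "k = 0 \<or> M (k - 1) (Suc l) = 0"
        unfolding M_def by (auto intro!: psi_odd simp del: power_Suc)
      then show ?thesis by auto
    qed
    then show ?thesis
      by (simp add: rotation_deriv_monomial diff psi_of_nat M_def del: power_Suc)
  qed
  \<comment> \<open>All polynomials are needed, since this is later applied to products
    \<open>u ^ k * v ^ l\<close> of linear forms.\<close>
  have "(\<lambda>p. \<psi> (rotation_deriv p)) = (\<lambda>p. 0)"
    using rot_mono
    by (intro bipoly_functional_eqI bipoly_functional_linearI)
      (simp_all add: rotation_deriv_add rotation_deriv_scale add scale)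
  then have psi_rot: "\<psi> (rotation_deriv p) = 0" for p by (rule fun_cong)

  have circ_mono: "\<psi> ((alpha1\<^sup>2 + alpha2\<^sup>2) * (alpha1 ^ k * alpha2 ^ l)) = \<psi> (alpha1 ^ k * alpha2 ^ l)" for k l
  proof -
    have "M (k + 2) l + M k (l + 2) = M k l"
    proof (cases "odd k \<or> odd l")
      case True
      then have "M (k + 2) l = 0" "M k (l + 2) = 0" "M k l = 0"
        unfolding M_def by (auto intro!: psi_odd simp del: power_Suc power_add_numeral2 add_2_eq_Suc')
      then show ?thesis by simp
    next
      case False
      then obtain m n where kl: "k = 2 * m" "l = 2 * n" by (auto elim!: evenE)
      have eqs: "M (k + 2) l = of_rat (Omega (Suc m) n)" "M k (l + 2) = of_rat (Omega m (Suc n))"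
        "M k l = of_rat (Omega m n)"
        using psi_even[of "Suc m" n] psi_even[of m "Suc n"] psi_even[of m n] by (simp_all add: M_def kl)
      show ?thesis unfolding eqs of_rat_add[symmetric] Omega_circle ..
    qed
    moreover have "(alpha1\<^sup>2 + alpha2\<^sup>2) * (alpha1 ^ k * alpha2 ^ l)
        = alpha1 ^ (k + 2) * alpha2 ^ l + alpha1 ^ k * (alpha2 ^ (l + 2) :: 'a bipoly)"
      by (simp add: algebra_simps power2_eq_square)
    ultimately show ?thesis by (simp only: M_def add)
  qed
  have "(\<lambda>p. \<psi> ((alpha1\<^sup>2 + alpha2\<^sup>2) * p)) = \<psi>"
    using circ_mono
    by (intro bipoly_functional_eqI bipoly_functional_linearI)
      (simp_all add: assms(1) distrib_left add scale[symmetric], simp_all add: bipoly_scale_conv_mult mult.left_commute)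
  then have psi_circ: "\<psi> ((alpha1\<^sup>2 + alpha2\<^sup>2) * p) = \<psi> p" for p by (rule fun_cong)

  have rot: "of_nat l * \<psi> (u ^ Suc k * v ^ (l - 1)) = of_nat k * \<psi> (u ^ (k - 1) * v ^ Suc l)"
    if "rotation_deriv u = - v" "rotation_deriv v = u" for u v k l
    using psi_rot[of "u ^ k * v ^ l"] that
    by (simp add: rotation_deriv_monomial diff psi_of_nat del: power_Suc)
  have circ: "\<psi> (u ^ (k + 2) * v ^ l) + \<psi> (u ^ k * v ^ (l + 2)) = \<psi> (u ^ k * v ^ l)"
    if "u\<^sup>2 + v\<^sup>2 = alpha1\<^sup>2 + alpha2\<^sup>2" for u v k l
  proof -
    have "u ^ (k + 2) * v ^ l + u ^ k * v ^ (l + 2) = (u\<^sup>2 + v\<^sup>2) * (u ^ k * v ^ l)"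
      by (simp add: algebra_simps power2_eq_square)
    then show ?thesis unfolding add[symmetric] by (simp only: that psi_circ)
  qed

  define a b where "a = h $ 1 $ 1" and "b = h $ 2 $ 1"
  \<comment> \<open>The second column of \<open>h\<close> is written through \<open>a\<close> and
    \<open>b\<close>, as \<open>SO2_entries\<close> permits.\<close>
  define u v where "u = bipoly_scale a alpha1 + bipoly_scale b alpha2"
    and "v = bipoly_scale (- b) alpha1 + bipoly_scale a alpha2"
  have act: "act h p = bipoly_subst p u v" for p
    using SO2_entries[OF assms(4)] by (simp add: act_def u_def v_def a_def b_def)
  have ab: "Const a * Const a + Const b * Const b = 1"
    using SO2_entries(3)[OF assms(4)] by (simp add: a_def b_def Const_def power2_eq_square one_pCons)
  have Cneg: "Const (- b) = - Const b" by (simp add: Const_def)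
  have uv_rot: "rotation_deriv u = - v" "rotation_deriv v = u"
    unfolding u_def v_def rotation_deriv_add rotation_deriv_scale
    by (simp_all add: bipoly_scale_conv_mult Cneg)
  have "u\<^sup>2 + v\<^sup>2 = (Const a * Const a + Const b * Const b) * (alpha1\<^sup>2 + alpha2\<^sup>2)"
    by (simp add: u_def v_def bipoly_scale_conv_mult Cneg power2_eq_square algebra_simps)
  then have uv_circ: "u\<^sup>2 + v\<^sup>2 = alpha1\<^sup>2 + alpha2\<^sup>2" by (simp add: ab)

  have "\<psi> (u ^ k * v ^ l) - \<psi> (alpha1 ^ k * alpha2 ^ l) = 0" for k l
  \<comment> \<open>Here \<open>E\<close> is the difference of the two moment families. Both
    recurrences are linear, and at \<open>k = l = 0\<close> both moments are \<psi> of 1.\<close>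
  proof (rule circle_moments_zero, goal_cases)
    case (1 k l)
    show ?case
      using rot[OF uv_rot, of l k] rot[OF rotation_deriv_alpha1 rotation_deriv_alpha2, of l k]
      by (simp only: right_diff_distrib)
  next
    case (2 k l)
    show ?case
      using circ[OF uv_circ, of k l] circ[OF refl, of k l] by (metis add_diff_add)
  qed simp
  moreover have "bipoly_subst (alpha1 ^ k * alpha2 ^ l) u v = u ^ k * v ^ l" for k l
    using bipoly_subst_monom[of 1 k l u v] by (simp add: bipoly_scale_def one_pCons[symmetric])
  ultimately have "\<psi> (act h (alpha1 ^ k * alpha2 ^ l)) = \<psi> (alpha1 ^ k * alpha2 ^ l)" for k l
    by (simp add: act)
  then have "(\<lambda>p. \<psi> (act h p)) = \<psi>"
    by (intro bipoly_functional_eqI bipoly_functional_linearI assms(1))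
      (simp_all add: act bipoly_subst_add bipoly_subst_scale add scale)
  then show ?thesis by (rule fun_cong)
qed

end
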